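(* $\bar n(t,d)<2d+(t-1)\frac d2+3$ for every even integer $d\ge 4$ and every integer $t\ge 2$.
   Context: An oriented matroid $M$ on a finite set $E$ is acyclic if it has no positive circuit. A reorientation of $M$ on $A\subseteq E$ is obtained by changing the signs of the elements of $A$ in all signed circuits of $M$; it is acyclic if the resulting oriented matroid is acyclic. An element $e$ of an acyclic oriented matroid is interior if there is a signed circuit $C=(C^+,C^-)$ with $C^-=\{e\}$. For integers $t\ge 0$, $d\ge 1$, $\bar n(t,d)$ is the largest integer $m$ such that every uniform oriented matroid of rank $d+1$ with $m$ elements has an acyclic reorientation with at most $t$ interior elements. *)

theory Defs
  imports Complex_Main
begin

(* A signed set X = (X\<^sup>+, X\<^sup>-) is a pair of sets, disjoint whenever X is a signed circuit;
   -X is prod.swap X. *)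
type_synonym 'a signed_set = "'a set \<times> 'a set"

definition support :: "'a signed_set \<Rightarrow> 'a set" where
  "support X = fst X \<union> snd X"

(* Signed circuit axioms, with weak elimination. *)
locale oriented_matroid =
  fixes E :: "'a set" and \<C> :: "'a signed_set set"
  assumes finite_ground: "finite E"
    and circuit_subset: "X \<in> \<C> \<Longrightarrow> support X \<subseteq> E"
    and circuit_disjoint: "X \<in> \<C> \<Longrightarrow> fst X \<inter> snd X = {}"
    and empty_not_circuit: "({}, {}) \<notin> \<C>"
    and circuit_symmetric: "X \<in> \<C> \<Longrightarrow> prod.swap X \<in> \<C>"
    and circuit_incomparable:
      "X \<in> \<C> \<Longrightarrow> Y \<in> \<C> \<Longrightarrow> support X \<subseteq> support Y \<Longrightarrow> X = Y \<or> X = prod.swap Y"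
    and circuit_elimination:
      "X \<in> \<C> \<Longrightarrow> Y \<in> \<C> \<Longrightarrow> X \<noteq> prod.swap Y \<Longrightarrow> e \<in> fst X \<inter> snd Y \<Longrightarrow>
        \<exists>Z\<in>\<C>. fst Z \<subseteq> (fst X \<union> fst Y) - {e} \<and> snd Z \<subseteq> (snd X \<union> snd Y) - {e}"

definition om_indep :: "'a set \<Rightarrow> 'a signed_set set \<Rightarrow> 'a set \<Rightarrow> bool" where
  "om_indep E \<C> I \<longleftrightarrow> I \<subseteq> E \<and> \<not> (\<exists>X\<in>\<C>. support X \<subseteq> I)"

definition om_rank :: "'a set \<Rightarrow> 'a signed_set set \<Rightarrow> nat" where
  "om_rank E \<C> = Max (card ` {I. om_indep E \<C> I})"

(* The underlying matroid is uniform: every subset of E whose size is the rank is a basis. *)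
definition om_uniform :: "'a set \<Rightarrow> 'a signed_set set \<Rightarrow> bool" where
  "om_uniform E \<C> \<longleftrightarrow> (\<forall>B\<subseteq>E. card B = om_rank E \<C> \<longrightarrow> om_indep E \<C> B)"

definition om_acyclic :: "'a signed_set set \<Rightarrow> bool" where
  "om_acyclic \<C> \<longleftrightarrow> \<not> (\<exists>X\<in>\<C>. snd X = {})"

definition flip_signs :: "'a set \<Rightarrow> 'a signed_set \<Rightarrow> 'a signed_set" where
  "flip_signs A X = ((fst X - A) \<union> (snd X \<inter> A), (snd X - A) \<union> (fst X \<inter> A))"

definition reorient :: "'a set \<Rightarrow> 'a signed_set set \<Rightarrow> 'a signed_set set" where
  "reorient A \<C> = flip_signs A ` \<C>"

definition interior_elements :: "'a set \<Rightarrow> 'a signed_set set \<Rightarrow> 'a set" where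
  "interior_elements E \<C> = {e \<in> E. \<exists>X\<in>\<C>. snd X = {e}}"

(* Every m-element ground set can be relabelled by natural numbers, so quantifying over
   ground sets E :: nat set covers all oriented matroids with m elements. *)
definition reorientable :: "nat \<Rightarrow> nat \<Rightarrow> nat \<Rightarrow> bool" where
  "reorientable t d m \<longleftrightarrow>
    (\<forall>(E :: nat set) \<C>.
      oriented_matroid E \<C> \<and> om_uniform E \<C> \<and> om_rank E \<C> = d + 1 \<and> card E = m \<longrightarrow>
      (\<exists>A\<subseteq>E. om_acyclic (reorient A \<C>) \<and> card (interior_elements E (reorient A \<C>)) \<le> t))"

(* If there were no largest m, GREATEST would be an unspecified number, about which no bound
   is provable; hence an upper bound on n_bar carries the existence of the maximum. *)
definition n_bar :: "nat \<Rightarrow> nat \<Rightarrow> nat" where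
  "n_bar t d = (GREATEST m. reorientable t d m)"

end

theory Submission imports Defs begin

text \<open>
The bound is witnessed by one uniform oriented matroid for each number \<open>m\<close> of elements that is at
least \<open>(t + 3) * (d div 2) + 3\<close>, which is the right-hand side of the claim: every acyclic
reorientation of it has more than \<open>t\<close> interior elements.

It is a Lawrence oriented matroid. Let \<open>a\<close> be a sign matrix with \<open>r = d + 1\<close> rows and \<open>m\<close> columns.
A signed circuit is a sequence of \<open>r + 1\<close> signed columns, from left to right, such that the
\<open>k\<close>-th and the next of them (counting from \<open>1\<close>) have opposite entries in row \<open>k\<close>. Reorienting amounts
to flipping columns, so the question is about all matrices obtained from \<open>a\<close> by column flips.

In such a matrix the top travel starts in row \<open>1\<close> at the first column, walks to the right and drops by
one row whenever the entry of its current row changes; the bottom travel starts in row \<open>r\<close> at the last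
column, walks to the left and rises by one row at each change. The row of the top travel at a column
tells how many terms of an all-positive circuit sequence fit before that column, and the row of the bottom
travel how many fit after it. Hence the reorientation is acyclic only if the top travel stays weakly above the bottom travel
(\<open>top_le_bottom\<close>), and a column is interior if neither travel turns there and they are at most one
row apart (\<open>interior_if_travels_adjacent\<close>): flipping it then makes room for one more term.

The matrix is chosen so that the signs of row \<open>k\<close> alternate up to column \<open>\<sigma> k\<close> and are constant from
there on, for increasing breakpoints \<open>\<sigma> k\<close>. On the step from column \<open>i\<close> to column \<open>i + 1\<close>, exactly one
of the travels turns if \<open>\<sigma> x \<le> i < \<sigma> y\<close>, where \<open>x\<close> and \<open>y\<close> are their rows on that step; otherwise both or
none turn.
The travels cannot stay two rows apart all the time: consecutive breakpoints have average distance
\<open>(t + 3) / 2\<close>, at least \<open>5 / 2\<close>, so a turn on every step while the current breakpoint lies between the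
travels uses up more turns than the two rows gained per breakpoint allow. At the left end the
breakpoint has not passed the top travel, and at the right end it has reached the bottom travel, so at
some time it overtakes both travels. Then they are at most one row apart and mostly idle for about
two breakpoint distances. A potential function (\<open>charge_bound\<close>) turns this into \<open>t + 1\<close> interior columns.
\<close>

section \<open>Chains of signed columns\<close>

text \<open>A column with a sign; the sign \<open>True\<close> stands for membership in the positive part.\<close>
type_synonym signed_column = "nat \<times> bool"

definition opposite :: "signed_column \<Rightarrow> signed_column" where
  "opposite z = (fst z, \<not> snd z)"

lemma fst_opposite [simp]: "fst (opposite z) = fst z"
  by (simp add: opposite_def)

lemma opposite_opposite [simp]: "opposite (opposite z) = z"
  by (simp add: opposite_def)

text \<open>The order \<open>lt\<close> and the row values \<open>v\<close> are parameters because the same facts are needed from left to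
right and, with the rows numbered backwards, from right to left.\<close>
inductive chain_to ::
  "(nat \<Rightarrow> nat \<Rightarrow> bool) \<Rightarrow> (nat \<Rightarrow> signed_column \<Rightarrow> bool) \<Rightarrow> signed_column set \<Rightarrow> nat \<Rightarrow> signed_column \<Rightarrow> bool"
  for lt v A where
  start: "z \<in> A \<Longrightarrow> chain_to lt v A 0 z"
| step: "chain_to lt v A i y \<Longrightarrow> lt (fst y) (fst z) \<Longrightarrow> v (Suc i) y \<noteq> v (Suc i) z \<Longrightarrow> z \<in> A \<Longrightarrow>
    chain_to lt v A (Suc i) z"

lemma chain_to_mem: "chain_to lt v A i z \<Longrightarrow> z \<in> A"
  by (induction rule: chain_to.induct) auto

lemma chain_to_mono:
  assumes "chain_to lt v A i z" and "A \<subseteq> B"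
  shows "chain_to lt v B i z"
  using assms by (induction rule: chain_to.induct) (auto intro: chain_to.intros)

text \<open>The last link joins opposite values in row \<open>Suc i\<close>. Among the values in any row, one of two opposite
ones differs from a given third; so the last column can be attached one position earlier, either to
the predecessor of its predecessor or, by induction, to its predecessor shortened in turn.\<close>
lemma chain_to_shorten_Suc:
  assumes "transp lt" and "chain_to lt v A (Suc i) z"
  shows "chain_to lt v A i z"
  using assms(2)
proof (induction i arbitrary: z)
  case 0
  then show ?case by (auto intro: chain_to.start chain_to_mem)
next
  case (Suc i)
  obtain y where y: "chain_to lt v A (Suc i) y" "lt (fst y) (fst z)"
      "v (Suc (Suc i)) y \<noteq> v (Suc (Suc i)) z" "z \<in> A"
    using Suc.prems by (cases rule: chain_to.cases) auto
  obtain x where x: "chain_to lt v A i x" "lt (fst x) (fst y)" "v (Suc i) x \<noteq> v (Suc i) y"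
    using y(1) by (cases rule: chain_to.cases) auto
  have xz: "lt (fst x) (fst z)"
    using assms(1) x(2) y(2) by (meson transpD)
  show ?case
  proof (cases "v (Suc i) x = v (Suc i) z")
    case True
    then show ?thesis
      using Suc.IH[OF y(1)] y(2,4) x(3) by (auto intro: chain_to.step)
  next
    case False
    then show ?thesis
      using x(1) xz y(4) by (auto intro: chain_to.step)
  qed
qed

lemma chain_to_shorten:
  assumes "transp lt" and "chain_to lt v A j z" and "i \<le> j"
  shows "chain_to lt v A i z"
  using assms(3,2)
  by (induction rule: inc_induct) (auto intro: chain_to_shorten_Suc[OF assms(1)])

text \<open>The same exchange shows that the positions available to a column only improve with distance: a later
column differs, in the row of the last link, from one of its two ends.\<close>
lemma chain_to_later:
  assumes "transp lt" and "chain_to lt v A i y" and "lt (fst y) (fst z)" and "z \<in> A"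
  shows "chain_to lt v A i z"
proof (cases i)
  case 0
  then show ?thesis using assms(4) by (simp add: chain_to.start)
next
  case (Suc j)
  obtain x where x: "chain_to lt v A j x" "lt (fst x) (fst y)" "v (Suc j) x \<noteq> v (Suc j) y"
    using assms(2) unfolding Suc by (cases rule: chain_to.cases) auto
  have y: "chain_to lt v A j y"
    using assms(1,2) Suc chain_to_shorten_Suc by blast
  have "lt (fst x) (fst z)"
    using assms(1,3) x(2) by (meson transpD)
  then show ?thesis
    unfolding Suc using x(1,3) y assms(3,4)
    by (cases "v (Suc j) x = v (Suc j) z") (auto intro: chain_to.step)
qed

lemma chain_to_of_sequence:
  assumes "\<And>j. j < i \<Longrightarrow> lt (fst (f j)) (fst (f (Suc j))) \<and> v (Suc j) (f j) \<noteq> v (Suc j) (f (Suc j))"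
    and "\<And>j. j \<le> i \<Longrightarrow> f j \<in> A"
  shows "chain_to lt v A i (f i)"
  using assms
proof (induction i)
  case 0
  then show ?case by (auto intro: chain_to.start)
next
  case (Suc i)
  then have "chain_to lt v A i (f i)" by auto
  then show ?case using Suc.prems by (auto intro: chain_to.step)
qed

lemma sequence_of_chain_to:
  assumes "chain_to lt v A i z"
  shows "\<exists>f. f i = z \<and> (\<forall>j\<le>i. f j \<in> A) \<and>
    (\<forall>j<i. lt (fst (f j)) (fst (f (Suc j))) \<and> v (Suc j) (f j) \<noteq> v (Suc j) (f (Suc j)))"
  using assms
proof (induction rule: chain_to.induct)
  case (start z)
  then show ?case by (intro exI[of _ "\<lambda>_. z"]) auto
next
  case (step i y z)
  then obtain f where f: "f i = y" "\<forall>j\<le>i. f j \<in> A"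
    "\<forall>j<i. lt (fst (f j)) (fst (f (Suc j))) \<and> v (Suc j) (f j) \<noteq> v (Suc j) (f (Suc j))" by auto
  show ?case
    using f step.hyps
    by (intro exI[of _ "f(Suc i := z)"]) (auto simp: less_Suc_eq le_Suc_eq)
qed

definition entry :: "(nat \<Rightarrow> nat \<Rightarrow> bool) \<Rightarrow> nat \<Rightarrow> signed_column \<Rightarrow> bool" where
  "entry a k z \<longleftrightarrow> a k (fst z) = snd z"

lemma entry_opposite [simp]: "entry a k (opposite z) \<longleftrightarrow> \<not> entry a k z"
  by (auto simp: entry_def opposite_def)

abbreviation forward :: "(nat \<Rightarrow> nat \<Rightarrow> bool) \<Rightarrow> signed_column set \<Rightarrow> nat \<Rightarrow> signed_column \<Rightarrow> bool" where
  "forward a \<equiv> chain_to (<) (entry a)"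

abbreviation backward :: "nat \<Rightarrow> (nat \<Rightarrow> nat \<Rightarrow> bool) \<Rightarrow> signed_column set \<Rightarrow> nat \<Rightarrow> signed_column \<Rightarrow> bool" where
  "backward r a \<equiv> chain_to (>) (\<lambda>j. entry a (Suc r - j))"

text \<open>A column that can be at position \<open>r - j\<close> from the left and has \<open>j\<close> more columns to its right completes
a chain: the backward chain is appended link by link.\<close>
lemma splice:
  assumes "backward r a A j z" and "j \<le> r" and "forward a A (r - j) z"
  shows "\<exists>w. forward a A r w"
  using assms
proof (induction rule: chain_to.induct)
  case (start z)
  then show ?case by (intro exI[of _ z]) simp
next
  case (step j y z)
  have "r - j = Suc (r - Suc j)" "Suc r - Suc j = r - j"
    using step.prems by auto
  moreover have "forward a A (Suc (r - Suc j)) y"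
    using step.prems(2) step.hyps chain_to_mem[OF step.hyps(1)] calculation
    by (intro chain_to.step) auto
  ultimately have "forward a A (r - j) y" by simp
  then show ?case using step.IH step.prems(1) by auto
qed

lemma splice_at:
  assumes "forward a A i z" and "backward r a A (r - i) z" and "i \<le> r"
  shows "\<exists>w. forward a A r w"
  using splice[OF assms(2)] assms(1,3) by auto

section \<open>Lawrence oriented matroids\<close>

definition signed_set_of :: "signed_column set \<Rightarrow> nat signed_set" where
  "signed_set_of F = ({c. (c, True) \<in> F}, {c. (c, False) \<in> F})"

definition alternating :: "nat \<Rightarrow> (nat \<Rightarrow> nat \<Rightarrow> bool) \<Rightarrow> (nat \<Rightarrow> signed_column) \<Rightarrow> bool" where
  "alternating r a f \<longleftrightarrow> (\<forall>i<r. fst (f i) < fst (f (Suc i)) \<and>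
     entry a (Suc i) (f i) \<noteq> entry a (Suc i) (f (Suc i)))"

definition lawrence_circuits :: "nat \<Rightarrow> (nat \<Rightarrow> nat \<Rightarrow> bool) \<Rightarrow> nat \<Rightarrow> nat signed_set set" where
  "lawrence_circuits r a n =
     {signed_set_of (f ` {..r}) | f. alternating r a f \<and> (\<forall>i\<le>r. fst (f i) < n)}"

lemma alternating_forward:
  assumes "alternating r a f" and "i \<le> r" and "\<And>j. j \<le> i \<Longrightarrow> f j \<in> A"
  shows "forward a A i (f i)"
  using assms by (intro chain_to_of_sequence) (auto simp: alternating_def)

lemma alternating_rev:
  assumes "alternating r a f" and "j < r"
  shows "fst (f (r - j)) > fst (f (r - Suc j)) \<and>
    entry a (Suc r - Suc j) (f (r - j)) \<noteq> entry a (Suc r - Suc j) (f (r - Suc j))"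
proof -
  have "Suc (r - Suc j) = r - j" using assms(2) by auto
  moreover have "r - Suc j < r" using assms(2) by auto
  ultimately show ?thesis
    using assms(1) unfolding alternating_def
    by (metis diff_Suc_Suc)
qed

lemma alternating_backward:
  assumes "alternating r a f" and "i \<le> r" and "\<And>j. i \<le> j \<Longrightarrow> j \<le> r \<Longrightarrow> f j \<in> A"
  shows "backward r a A (r - i) (f i)"
proof -
  have "backward r a A (r - i) ((\<lambda>j. f (r - j)) (r - i))"
    by (rule chain_to_of_sequence) (use alternating_rev[OF assms(1)] assms(2,3) in auto)
  then show ?thesis using assms(2) by simp
qed

lemma circuit_of_forward:
  assumes "forward a A r w" and "\<And>z. z \<in> A \<Longrightarrow> fst z < n"
  shows "\<exists>Z\<in>lawrence_circuits r a n. fst Z \<subseteq> {c. (c, True) \<in> A} \<and> snd Z \<subseteq> {c. (c, False) \<in> A}"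
proof -
  obtain f where f: "\<forall>j\<le>r. f j \<in> A" "alternating r a f"
    using sequence_of_chain_to[OF assms(1)] by (auto simp: alternating_def)
  then have "signed_set_of (f ` {..r}) \<in> lawrence_circuits r a n"
    unfolding lawrence_circuits_def using assms(2) by blast
  moreover have "f ` {..r} \<subseteq> A" using f by auto
  ultimately show ?thesis
    by (intro bexI[of _ "signed_set_of (f ` {..r})"]) (auto simp: signed_set_of_def)
qed

lemma alternating_less:
  assumes "alternating r a f" and "i < j" and "j \<le> r"
  shows "fst (f i) < fst (f j)"
  using assms(2,3)
proof (induction j)
  case (Suc j)
  have "fst (f j) < fst (f (Suc j))"
    using assms(1) Suc.prems by (auto simp: alternating_def)
  then show ?case using Suc by (cases "i = j") auto
qed simp

lemma alternating_eq_iff: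
  assumes "alternating r a f" and "i \<le> r" and "j \<le> r"
  shows "fst (f i) = fst (f j) \<longleftrightarrow> i = j"
  using alternating_less[OF assms(1), of i j] alternating_less[OF assms(1), of j i] assms(2,3)
  by (cases i j rule: linorder_cases) auto

text \<open>Two chains that meet in the same column with opposite signs, at the same position, are either opposite
throughout or else a third chain reaches that position before the common column. Follow them down until
their columns first differ; the two columns found there have opposite values in the row that links
them to the common part, so they can be linked to each other, which gains one position. While the
columns agree, both signs of each column are available, so the gain can be carried back up.\<close>
lemma first_difference:
  assumes lt: "\<And>c c'. c \<noteq> c' \<Longrightarrow> lt c c' \<or> lt c' c" and tr: "transp lt"
    and v: "\<And>k z. v k (opposite z) \<longleftrightarrow> \<not> v k z"
    and f: "\<And>j. j < p \<Longrightarrow> lt (fst (f j)) (fst (f (Suc j))) \<and> v (Suc j) (f j) \<noteq> v (Suc j) (f (Suc j))"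
    and g: "\<And>j. j < p \<Longrightarrow> lt (fst (g j)) (fst (g (Suc j))) \<and> v (Suc j) (g j) \<noteq> v (Suc j) (g (Suc j))"
    and A: "\<And>j. j < p \<Longrightarrow> f j \<in> A \<and> g j \<in> A"
    and "i \<le> p" and "g i = opposite (f i)"
  shows "(\<forall>j\<le>i. g j = opposite (f j)) \<or> (\<exists>u. lt (fst u) (fst (f i)) \<and> chain_to lt v A i u)"
  using assms(7,8)
proof (induction i)
  case 0
  then show ?case by auto
next
  case (Suc i)
  have fi: "lt (fst (f i)) (fst (f (Suc i)))" "v (Suc i) (f i) \<noteq> v (Suc i) (f (Suc i))"
    and gi: "lt (fst (g i)) (fst (f (Suc i)))" "v (Suc i) (g i) = v (Suc i) (f (Suc i))"
    using f[of i] g[of i] Suc.prems v by auto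
  have cf: "chain_to lt v A i (f i)" and cg: "chain_to lt v A i (g i)"
    using Suc.prems f g A by (auto intro!: chain_to_of_sequence)
  have mem: "f i \<in> A" "g i \<in> A" using A Suc.prems by auto
  show ?case
  proof (cases "fst (f i) = fst (g i)")
    case False
    then consider "lt (fst (f i)) (fst (g i))" | "lt (fst (g i)) (fst (f i))" using lt by blast
    then show ?thesis
    proof cases
      case 1
      then have "chain_to lt v A (Suc i) (g i)" using fi gi mem by (intro chain_to.step[OF cf]) auto
      then show ?thesis using gi by blast
    next
      case 2
      then have "chain_to lt v A (Suc i) (f i)" using fi gi mem by (intro chain_to.step[OF cg]) auto
      then show ?thesis using fi by blast
    qed
  next
    case True
    have opp: "g i = opposite (f i)"
    proof -
      have "g i \<noteq> f i" using fi gi by auto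
      then show ?thesis using True by (auto simp: opposite_def prod_eq_iff)
    qed
    then consider "\<forall>j\<le>i. g j = opposite (f j)"
      | u where "lt (fst u) (fst (f i))" "chain_to lt v A i u"
      using Suc.IH Suc.prems by auto
    then show ?thesis
    proof cases
      case 1
      then show ?thesis using Suc.prems by (auto simp: le_Suc_eq)
    next
      case 2
      have "chain_to lt v A (Suc i) (if v (Suc i) u = v (Suc i) (f i) then g i else f i)"
        using 2 mem True fi gi by (auto intro!: chain_to.step[OF 2(2)])
      then show ?thesis using fi gi by (metis (full_types))
    qed
  qed
qed

text \<open>If \<open>e\<close> comes later in \<open>f\<close> than in \<open>g\<close>, the part of \<open>f\<close> before \<open>e\<close> and the part of \<open>g\<close> after \<open>e\<close>
together have at least \<open>r + 1\<close> columns, and the first column of the latter part fits after the former.\<close>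
lemma eliminate_index_less:
  assumes f: "alternating r a f" and g: "alternating r a g"
    and e: "f p = (e, s)" "g q = (e, \<not> s)" and "q < p" "p \<le> r"
    and A: "A = {z \<in> f ` {..r} \<union> g ` {..r}. fst z \<noteq> e}"
  shows "\<exists>w. forward a A r w"
proof -
  have fA: "f j \<in> A" if "j < p" for j
    using that alternating_less[OF f that] \<open>p \<le> r\<close> e A by auto
  have gA: "g j \<in> A" if "q < j" "j \<le> r" for j
    using that alternating_less[OF g that] e A by auto
  obtain p' where p': "p = Suc p'" using \<open>q < p\<close> by (cases p) auto
  have fw: "forward a A p' (f p')"
    using fA p' \<open>p \<le> r\<close> by (intro alternating_forward[OF f]) auto
  have bw: "backward r a A (r - Suc q) (g (Suc q))"
    using gA \<open>q < p\<close> \<open>p \<le> r\<close> by (intro alternating_backward[OF g]) auto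
  have lf: "fst (f p') < e" "entry a p (f p') \<noteq> entry a p (e, s)"
    using f \<open>p \<le> r\<close> p' e by (auto simp: alternating_def Suc_le_eq)
  have lg: "e < fst (g (Suc q))" "entry a (Suc q) (e, \<not> s) \<noteq> entry a (Suc q) (g (Suc q))"
    using g \<open>p \<le> r\<close> \<open>q < p\<close> e by (auto simp: alternating_def dest!: spec[of _ q])
  have lt: "fst (f p') < fst (g (Suc q))" using lf lg by simp
  have mem: "g (Suc q) \<in> A" using gA \<open>p \<le> r\<close> \<open>q < p\<close> by auto
  have "forward a A (Suc q) (g (Suc q))"
  proof (cases "p' = q")
    case True
    have "entry a p (f p') \<noteq> entry a p (g (Suc q))"
      using lf lg True p' by (auto simp: entry_def)
    then show ?thesis using fw lt True p' mem by (auto intro: chain_to.step)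
  next
    case False
    then have "Suc q \<le> p'" using \<open>q < p\<close> p' by simp
    then have "forward a A (Suc q) (f p')" using fw by (auto intro: chain_to_shorten)
    then show ?thesis using lt mem by (auto intro: chain_to_later)
  qed
  then show ?thesis using bw \<open>q < p\<close> \<open>p \<le> r\<close> by (intro splice_at[of _ _ "Suc q"]) auto
qed

text \<open>If \<open>e\<close> has the same position \<open>p\<close> in both chains, removing it leaves a gap of one position. Since \<open>f\<close> and
\<open>g\<close> are not opposite, \<open>first_difference\<close> supplies on one side of \<open>e\<close> a column \<open>u\<close> that fills position
\<open>p\<close>. On the other side the neighbours of \<open>e\<close> in \<open>f\<close> and \<open>g\<close> have opposite values in the linking row, so one of them
can be linked to \<open>u\<close>.\<close>
lemma eliminate_same_index:
  assumes f: "alternating r a f" and g: "alternating r a g"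
    and e: "f p = (e, s)" "g p = (e, \<not> s)" and p: "p \<le> r"
    and ne: "\<not> (\<forall>i\<le>r. g i = opposite (f i))"
    and A: "A = {z \<in> f ` {..r} \<union> g ` {..r}. fst z \<noteq> e}"
  shows "\<exists>w. forward a A r w"
proof -
  have mem: "f j \<in> A" "g j \<in> A" if "j \<noteq> p" "j \<le> r" for j
    using that p e A alternating_eq_iff[OF f, of j p] alternating_eq_iff[OF g, of j p] by auto
  have opp: "g p = opposite (f p)" using e by (simp add: opposite_def)
  have left: "(\<forall>j\<le>p. g j = opposite (f j)) \<or> (\<exists>u. fst u < fst (f p) \<and> forward a A p u)"
    by (rule first_difference[where p = p])
      (use mem opp p f g in \<open>auto simp: alternating_def linorder_neq_iff\<close>)
  have mem_rev: "f (r - j) \<in> A \<and> g (r - j) \<in> A" if "j < r - p" for j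
    using mem[of "r - j"] that by auto
  let ?f = "\<lambda>j. f (r - j)" and ?g = "\<lambda>j. g (r - j)"
  have "(\<forall>j\<le>r - p. ?g j = opposite (?f j)) \<or>
      (\<exists>u. fst u > fst (?f (r - p)) \<and> backward r a A (r - p) u)"
    by (rule first_difference[where p = "r - p" and g = ?g])
      (use mem_rev opp p alternating_rev[OF f] alternating_rev[OF g]
        in \<open>auto simp: linorder_neq_iff transp_def\<close>)
  moreover have "g j = opposite (f j)" if "\<forall>j\<le>r - p. ?g j = opposite (?f j)" "p \<le> j" "j \<le> r" for j
    using that(1)[rule_format, of "r - j"] that by auto
  ultimately have right: "(\<forall>j. p \<le> j \<and> j \<le> r \<longrightarrow> g j = opposite (f j)) \<or>
      (\<exists>u. fst u > e \<and> backward r a A (r - p) u)"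
    using p e by auto
  consider u where "fst u < e" "forward a A p u" | u where "fst u > e" "backward r a A (r - p) u"
    using left right ne e by (metis fst_conv nle_le)
  then show ?thesis
  proof cases
    case 1
    show ?thesis
    proof (cases "p = r")
      case True
      then show ?thesis using 1 by blast
    next
      case False
      then have *: "p < r" using p by simp
      have nf: "e < fst (f (Suc p))" "entry a (Suc p) (e, s) \<noteq> entry a (Suc p) (f (Suc p))"
        and ng: "e < fst (g (Suc p))" "entry a (Suc p) (e, \<not> s) \<noteq> entry a (Suc p) (g (Suc p))"
        using f g * e by (auto simp: alternating_def dest!: spec[of _ p])
      then have "entry a (Suc p) (f (Suc p)) \<noteq> entry a (Suc p) (g (Suc p))"
        by (auto simp: entry_def)
      then obtain z where z: "z = f (Suc p) \<or> z = g (Suc p)" "entry a (Suc p) u \<noteq> entry a (Suc p) z"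
        by metis
      have "backward r a A (r - Suc p) z"
        using z(1) * mem alternating_backward[OF f, of "Suc p" A] alternating_backward[OF g, of "Suc p" A]
        by auto
      moreover have "forward a A (Suc p) z"
        using z 1 nf ng mem * by (intro chain_to.step[OF 1(2)]) auto
      ultimately show ?thesis using * by (intro splice_at[of _ _ "Suc p"]) auto
    qed
  next
    case 2
    have "forward a A p u"
    proof (cases p)
      case 0
      then show ?thesis using chain_to_mem[OF 2(2)] by (simp add: chain_to.start)
    next
      case (Suc p')
      have nf: "fst (f p') < e" "entry a p (e, s) \<noteq> entry a p (f p')"
        and ng: "fst (g p') < e" "entry a p (e, \<not> s) \<noteq> entry a p (g p')"
        using f g p e Suc by (auto simp: alternating_def dest!: spec[of _ p'])
      then have "entry a p (f p') \<noteq> entry a p (g p')"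
        by (auto simp: entry_def)
      then obtain z where z: "z = f p' \<or> z = g p'" "entry a p z \<noteq> entry a p u"
        by metis
      have "forward a A p' z"
        using z(1) Suc p mem alternating_forward[OF f, of p' A] alternating_forward[OF g, of p' A]
        by auto
      then show ?thesis
        unfolding Suc using z nf ng 2 chain_to_mem[OF 2(2)] Suc by (intro chain_to.step) auto
    qed
    then show ?thesis using 2 p by (intro splice_at[of _ _ p]) auto
  qed
qed

definition columns :: "nat \<Rightarrow> (nat \<Rightarrow> signed_column) \<Rightarrow> nat set" where
  "columns r f = (\<lambda>i. fst (f i)) ` {..r}"

lemma support_signed_set_of: "support (signed_set_of (f ` {..r})) = columns r f"
proof -
  have "support (signed_set_of F) = fst ` F" for F
  proof (intro equalityI subsetI)
    fix c assume "c \<in> fst ` F"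
    then obtain b where "(c, b) \<in> F" by auto
    then show "c \<in> support (signed_set_of F)"
      by (cases b) (auto simp: support_def signed_set_of_def)
  qed (force simp: support_def signed_set_of_def)
  then show ?thesis by (simp add: columns_def image_image)
qed

lemma swap_signed_set_of:
  "prod.swap (signed_set_of (f ` {..r})) = signed_set_of ((\<lambda>i. opposite (f i)) ` {..r})"
proof -
  have "z \<in> (\<lambda>i. opposite (f i)) ` {..r} \<longleftrightarrow> opposite z \<in> f ` {..r}" for z
    by (auto simp: image_iff) (metis atMost_iff opposite_opposite)
  then show ?thesis by (simp add: signed_set_of_def opposite_def)
qed

lemma card_columns:
  assumes "alternating r a f"
  shows "card (columns r f) = Suc r"
proof -
  have "inj_on (\<lambda>i. fst (f i)) {..r}"
    using alternating_eq_iff[OF assms] by (auto simp: inj_on_def)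
  then show ?thesis by (simp add: columns_def card_image)
qed

text \<open>The columns of a circuit determine it up to sign, since each link fixes the sign of the next column.\<close>
lemma alternating_unique:
  assumes f: "alternating r a f" and g: "alternating r a g" and "columns r f = columns r g"
  shows "(\<forall>i\<le>r. g i = f i) \<or> (\<forall>i\<le>r. g i = opposite (f i))"
proof -
  have sorted: "map (\<lambda>i. fst (h i)) [0..<Suc r] = sorted_list_of_set (columns r h)"
    if "alternating r a h" for h
  proof -
    have "sorted_wrt (<) (map (\<lambda>i. fst (h i)) [0..<Suc r])"
      using alternating_less[OF that] by (auto simp: sorted_wrt_iff_nth_less simp del: upt_Suc)
    moreover have "set (map (\<lambda>i. fst (h i)) [0..<Suc r]) = columns r h"
      by (auto simp: columns_def simp del: upt_Suc)
    ultimately show ?thesis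
      by (metis sorted_list_of_set.idem_if_sorted_distinct strict_sorted_iff)
  qed
  have "map (\<lambda>i. fst (f i)) [0..<Suc r] = map (\<lambda>i. fst (g i)) [0..<Suc r]"
    using sorted[OF f] sorted[OF g] assms(3) by simp
  then have fst: "fst (g i) = fst (f i)" if "i \<le> r" for i
    using that by (auto simp del: upt_Suc)
  have sgn: "(snd (g i) = snd (f i)) = (snd (g 0) = snd (f 0))" if "i \<le> r" for i
    using that
  proof (induction i)
    case (Suc i)
    have "entry a (Suc i) (f i) \<noteq> entry a (Suc i) (f (Suc i))"
      "entry a (Suc i) (g i) \<noteq> entry a (Suc i) (g (Suc i))"
      using f g Suc.prems by (auto simp: alternating_def)
    then have "(snd (g (Suc i)) = snd (f (Suc i))) = (snd (g i) = snd (f i))"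
      using fst[of i] fst[of "Suc i"] Suc.prems by (auto simp: entry_def)
    then show ?case using Suc by auto
  qed simp
  show ?thesis
  proof (cases "snd (g 0) = snd (f 0)")
    case True
    then have "g i = f i" if "i \<le> r" for i
      using fst[OF that] sgn[OF that] by (intro prod_eqI) auto
    then show ?thesis by blast
  next
    case False
    then have "g i = opposite (f i)" if "i \<le> r" for i
      using fst[OF that] sgn[OF that] by (intro prod_eqI) (auto simp: opposite_def)
    then show ?thesis by blast
  qed
qed

lemma lawrence_circuitE:
  assumes "X \<in> lawrence_circuits r a n"
  obtains f where "X = signed_set_of (f ` {..r})" "alternating r a f" "\<And>i. i \<le> r \<Longrightarrow> fst (f i) < n"
  using assms by (auto simp: lawrence_circuits_def)

lemma alternating_opposite:
  "alternating r a f \<Longrightarrow> alternating r a (\<lambda>i. opposite (f i))"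
  by (simp add: alternating_def)

lemma lawrence_circuit_elimination:
  assumes X: "X \<in> lawrence_circuits r a n" and Y: "Y \<in> lawrence_circuits r a n"
    and "X \<noteq> prod.swap Y" and e: "e \<in> fst X \<inter> snd Y"
  shows "\<exists>Z\<in>lawrence_circuits r a n.
    fst Z \<subseteq> (fst X \<union> fst Y) - {e} \<and> snd Z \<subseteq> (snd X \<union> snd Y) - {e}"
proof -
  obtain f where f: "X = signed_set_of (f ` {..r})" "alternating r a f" "\<And>i. i \<le> r \<Longrightarrow> fst (f i) < n"
    using X by (rule lawrence_circuitE) blast
  obtain g where g: "Y = signed_set_of (g ` {..r})" "alternating r a g" "\<And>i. i \<le> r \<Longrightarrow> fst (g i) < n"
    using Y by (rule lawrence_circuitE) blast
  obtain p q where p: "f p = (e, True)" "p \<le> r" and q: "g q = (e, False)" "q \<le> r"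
    using e f(1) g(1) by (auto simp: signed_set_of_def image_iff)
  have "X = prod.swap Y" if "\<forall>i\<le>r. g i = opposite (f i)"
  proof -
    have "(\<lambda>i. opposite (g i)) ` {..r} = f ` {..r}" using that by (auto simp: image_iff)
    then show ?thesis using f(1) g(1) swap_signed_set_of[of g r] by simp
  qed
  then have ne: "\<not> (\<forall>i\<le>r. g i = opposite (f i))" using assms(3) by blast
  define A where "A = {z \<in> f ` {..r} \<union> g ` {..r}. fst z \<noteq> e}"
  have "\<exists>w. forward a A r w"
  proof (cases p q rule: linorder_cases)
    case less
    show ?thesis
      by (rule eliminate_index_less[OF g(2) f(2), of q e False p]) (use less p q A_def in auto)
  next
    case equal
    show ?thesis
      by (rule eliminate_same_index[OF f(2) g(2), of p e True]) (use equal p q ne A_def in auto)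
  next
    case greater
    show ?thesis
      by (rule eliminate_index_less[OF f(2) g(2), of p e True q]) (use greater p q A_def in auto)
  qed
  then obtain w where w: "forward a A r w" by blast
  have "fst z < n" if "z \<in> A" for z
    using that f(3) g(3) by (auto simp: A_def)
  from circuit_of_forward[OF w this] obtain Z where
    Z: "Z \<in> lawrence_circuits r a n" "fst Z \<subseteq> {c. (c, True) \<in> A}" "snd Z \<subseteq> {c. (c, False) \<in> A}"
    by blast
  have "{c. (c, True) \<in> A} \<subseteq> (fst X \<union> fst Y) - {e}" "{c. (c, False) \<in> A} \<subseteq> (snd X \<union> snd Y) - {e}"
    using f(1) g(1) by (auto simp: A_def signed_set_of_def)
  then show ?thesis using Z by blast
qed

lemma lawrence_oriented_matroid: "oriented_matroid {..<n} (lawrence_circuits r a n)"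
proof
  show "finite {..<n}" by simp
next
  fix X assume "X \<in> lawrence_circuits r a n"
  then obtain f where f: "X = signed_set_of (f ` {..r})" "alternating r a f" "\<And>i. i \<le> r \<Longrightarrow> fst (f i) < n"
    by (rule lawrence_circuitE) blast
  show "support X \<subseteq> {..<n}"
    using f(1,3) by (auto simp: support_signed_set_of columns_def)
  show "fst X \<inter> snd X = {}"
  proof (rule ccontr)
    assume "fst X \<inter> snd X \<noteq> {}"
    then obtain c i j where "f i = (c, True)" "f j = (c, False)" "i \<le> r" "j \<le> r"
      using f(1) by (auto simp: signed_set_of_def image_iff) metis
    then show False using alternating_eq_iff[OF f(2), of i j] by auto
  qed
  have "alternating r a (\<lambda>i. opposite (f i)) \<and> (\<forall>i\<le>r. fst (opposite (f i)) < n)"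
    using alternating_opposite f(2,3) by simp
  then show "prod.swap X \<in> lawrence_circuits r a n"
    unfolding f(1) swap_signed_set_of lawrence_circuits_def by blast
  fix Y assume "Y \<in> lawrence_circuits r a n" and sub: "support X \<subseteq> support Y"
  then obtain g where g: "Y = signed_set_of (g ` {..r})" "alternating r a g"
    by (auto elim: lawrence_circuitE)
  have "columns r f = columns r g"
    using sub card_columns[OF f(2)] card_columns[OF g(2)]
    by (intro card_subset_eq) (auto simp: f(1) g(1) support_signed_set_of columns_def)
  then consider "\<forall>i\<le>r. f i = g i" | "\<forall>i\<le>r. f i = opposite (g i)"
    using alternating_unique[OF g(2) f(2)] by auto
  then show "X = Y \<or> X = prod.swap Y"
  proof cases
    case 1
    then have "f ` {..r} = g ` {..r}" by (auto simp: image_iff)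
    then show ?thesis using f(1) g(1) by simp
  next
    case 2
    then have "f ` {..r} = (\<lambda>i. opposite (g i)) ` {..r}" by (auto simp: image_iff)
    then show ?thesis using f(1) g(1) by (simp add: swap_signed_set_of)
  qed
next
  show "({}, {}) \<notin> lawrence_circuits r a n"
  proof
    assume "({}, {}) \<in> lawrence_circuits r a n"
    then obtain f where "({}, {}) = signed_set_of (f ` {..r})"
      by (rule lawrence_circuitE) blast
    then have "support (signed_set_of (f ` {..r})) = {}" by (metis support_def fst_conv snd_conv Un_empty)
    then show False by (simp add: support_signed_set_of columns_def)
  qed
next
  fix X Y e
  assume "X \<in> lawrence_circuits r a n" "Y \<in> lawrence_circuits r a n" "X \<noteq> prod.swap Y" "e \<in> fst X \<inter> snd Y"
  then show "\<exists>Z\<in>lawrence_circuits r a n.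
    fst Z \<subseteq> fst X \<union> fst Y - {e} \<and> snd Z \<subseteq> snd X \<union> snd Y - {e}"
    by (rule lawrence_circuit_elimination)
qed

lemma alternating_on_columns:
  assumes "finite J" and "card J = Suc r"
  shows "\<exists>f. alternating r a f \<and> columns r f = J"
proof -
  define c where "c i = sorted_list_of_set J ! i" for i
  have len: "length (sorted_list_of_set J) = Suc r" using assms by simp
  have c: "c i < c (Suc i)" if "i < r" for i
    using sorted_wrt_nth_less[OF strict_sorted_list_of_set[of J], of i "Suc i"] that len
    by (simp add: c_def)
  define s where "s = rec_nat True (\<lambda>i x. a (Suc i) (c (Suc i)) = (a (Suc i) (c i) \<noteq> x))"
  have "alternating r a (\<lambda>i. (c i, s i))"
    using c by (auto simp: alternating_def entry_def s_def)
  moreover have "columns r (\<lambda>i. (c i, s i)) = J"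
  proof -
    have nths: "(!) xs ` {..<length xs} = set xs" for xs :: "nat list"
      by (auto simp: set_conv_nth)
    have "columns r (\<lambda>i. (c i, s i)) = (!) (sorted_list_of_set J) ` {..<Suc r}"
      by (auto simp: columns_def c_def lessThan_Suc_atMost)
    also have "\<dots> = set (sorted_list_of_set J)"
      using nths[of "sorted_list_of_set J"] unfolding len .
    finally show ?thesis using assms(1) by simp
  qed
  ultimately show ?thesis by blast
qed

lemma lawrence_indep_iff:
  "om_indep {..<n} (lawrence_circuits r a n) I \<longleftrightarrow> I \<subseteq> {..<n} \<and> card I \<le> r"
proof (intro iffI conjI)
  assume indep: "om_indep {..<n} (lawrence_circuits r a n) I"
  then show I: "I \<subseteq> {..<n}" by (simp add: om_indep_def)
  show "card I \<le> r"
  proof (rule ccontr)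
    assume "\<not> card I \<le> r"
    then obtain J where J: "J \<subseteq> I" "card J = Suc r" "finite J"
      by (metis not_less_eq_eq obtain_subset_with_card_n)
    obtain f where f: "alternating r a f" "columns r f = J"
      using alternating_on_columns J by blast
    then have "\<forall>i\<le>r. fst (f i) < n" using J I by (auto simp: columns_def)
    then have "signed_set_of (f ` {..r}) \<in> lawrence_circuits r a n"
      using f by (auto simp: lawrence_circuits_def)
    moreover have "support (signed_set_of (f ` {..r})) \<subseteq> I"
      using f J by (simp add: support_signed_set_of)
    ultimately show False using indep by (auto simp: om_indep_def)
  qed
next
  assume I: "I \<subseteq> {..<n} \<and> card I \<le> r"
  have "\<not> support X \<subseteq> I" if X: "X \<in> lawrence_circuits r a n" for X
  proof -
    obtain f where "X = signed_set_of (f ` {..r})" "alternating r a f"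
      using lawrence_circuitE[OF X] by metis
    then have "card (support X) = Suc r" by (simp add: support_signed_set_of card_columns)
    moreover have "finite I" using I finite_subset by blast
    ultimately show ?thesis using I card_mono[of I "support X"] by auto
  qed
  then show "om_indep {..<n} (lawrence_circuits r a n) I" using I by (auto simp: om_indep_def)
qed

lemma lawrence_rank:
  assumes "r \<le> n"
  shows "om_rank {..<n} (lawrence_circuits r a n) = r"
proof -
  have "card ` {I. om_indep {..<n} (lawrence_circuits r a n) I} = {..r}"
  proof (intro equalityI subsetI)
    fix m assume "m \<in> {..r}"
    then have "om_indep {..<n} (lawrence_circuits r a n) {..<m}" "card {..<m} = m"
      using assms by (auto simp: lawrence_indep_iff)
    then show "m \<in> card ` {I. om_indep {..<n} (lawrence_circuits r a n) I}"
      by (intro image_eqI[of _ _ "{..<m}"]) auto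
  qed (auto simp: lawrence_indep_iff)
  moreover have "Max {..r} = r" by (rule Max_eqI) auto
  ultimately show ?thesis by (simp add: om_rank_def)
qed

lemma lawrence_uniform: "r \<le> n \<Longrightarrow> om_uniform {..<n} (lawrence_circuits r a n)"
  by (simp add: om_uniform_def lawrence_rank lawrence_indep_iff)

definition flip_columns :: "nat set \<Rightarrow> (nat \<Rightarrow> nat \<Rightarrow> bool) \<Rightarrow> nat \<Rightarrow> nat \<Rightarrow> bool" where
  "flip_columns A a k c \<longleftrightarrow> a k c \<noteq> (c \<in> A)"

lemma flip_signs_lawrence_circuit:
  assumes "X \<in> lawrence_circuits r a n"
  shows "flip_signs A X \<in> lawrence_circuits r (flip_columns A a) n"
proof -
  obtain f where f: "X = signed_set_of (f ` {..r})" "alternating r a f" "\<And>i. i \<le> r \<Longrightarrow> fst (f i) < n"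
    using assms by (rule lawrence_circuitE) blast
  define \<phi> where "\<phi> z = (fst z, snd z \<noteq> (fst z \<in> A))" for z :: signed_column
  have \<phi>\<phi>: "\<phi> (\<phi> z) = z" for z by (auto simp: \<phi>_def prod_eq_iff)
  define g where "g i = \<phi> (f i)" for i
  have "entry (flip_columns A a) k (g i) = entry a k (f i)" for k i
    by (auto simp: entry_def flip_columns_def g_def \<phi>_def)
  then have "alternating r (flip_columns A a) g" using f(2) by (simp add: alternating_def g_def \<phi>_def)
  moreover have "fst (g i) < n" if "i \<le> r" for i using f(3) that by (simp add: g_def \<phi>_def)
  moreover have "flip_signs A X = signed_set_of (g ` {..r})"
  proof -
    define F G where "F = f ` {..r}" and "G = g ` {..r}"
    have "G = \<phi> ` F" by (simp add: F_def G_def g_def image_image)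
    then have "z \<in> G \<longleftrightarrow> \<phi> z \<in> F" for z
      using \<phi>\<phi> by (metis image_iff)
    then have "(c, True) \<in> G \<longleftrightarrow> (if c \<in> A then (c, False) \<in> F else (c, True) \<in> F)"
      "(c, False) \<in> G \<longleftrightarrow> (if c \<in> A then (c, True) \<in> F else (c, False) \<in> F)" for c
      by (auto simp: \<phi>_def)
    then show ?thesis
      unfolding f(1) F_def[symmetric] G_def[symmetric] signed_set_of_def flip_signs_def by auto
  qed
  ultimately show ?thesis by (auto simp: lawrence_circuits_def)
qed

lemma flip_signs_twice: "fst X \<inter> snd X = {} \<Longrightarrow> flip_signs A (flip_signs A X) = X"
  by (cases X) (auto simp: flip_signs_def)

text \<open>Reorienting stays within the family, so acyclic reorientations can be studied as acyclic matrices.\<close>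
lemma reorient_lawrence:
  "reorient A (lawrence_circuits r a n) = lawrence_circuits r (flip_columns A a) n"
proof
  show "reorient A (lawrence_circuits r a n) \<subseteq> lawrence_circuits r (flip_columns A a) n"
    using flip_signs_lawrence_circuit by (auto simp: reorient_def)
next
  have [simp]: "flip_columns A (flip_columns A a) = a"
    by (auto simp: flip_columns_def fun_eq_iff)
  show "lawrence_circuits r (flip_columns A a) n \<subseteq> reorient A (lawrence_circuits r a n)"
  proof
    fix X assume X: "X \<in> lawrence_circuits r (flip_columns A a) n"
    then have "fst X \<inter> snd X = {}"
      using lawrence_oriented_matroid by (rule oriented_matroid.circuit_disjoint[rotated])
    then have "flip_signs A (flip_signs A X) = X" by (rule flip_signs_twice)
    moreover have "flip_signs A X \<in> lawrence_circuits r a n"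
      using flip_signs_lawrence_circuit[OF X, of A] by simp
    ultimately show "X \<in> reorient A (lawrence_circuits r a n)"
      unfolding reorient_def by (metis imageI)
  qed
qed

section \<open>Top and bottom travels\<close>

definition positive_columns :: "nat \<Rightarrow> nat \<Rightarrow> signed_column set" where
  "positive_columns i j = {i..j} \<times> {True}"

lemma acyclic_no_full_chain:
  assumes "om_acyclic (lawrence_circuits r B (Suc N))"
  shows "\<not> forward B (positive_columns 0 N) r w"
proof
  assume "forward B (positive_columns 0 N) r w"
  then obtain Z where "Z \<in> lawrence_circuits r B (Suc N)"
      "snd Z \<subseteq> {c. (c, False) \<in> positive_columns 0 N}"
    using circuit_of_forward[of B "positive_columns 0 N" r w "Suc N"] by (auto simp: positive_columns_def)
  then show False using assms by (auto simp: om_acyclic_def positive_columns_def)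
qed

text \<open>Rows are numbered from \<open>1\<close>. The value at column \<open>i\<close> is the row after a possible turn at \<open>i\<close>, so that
\<open>i\<close> can be at position \<open>top_travel B i - 1\<close> of a positive chain.\<close>
fun top_travel :: "(nat \<Rightarrow> nat \<Rightarrow> bool) \<Rightarrow> nat \<Rightarrow> nat" where
  "top_travel B 0 = 1"
| "top_travel B (Suc i) = top_travel B i +
     of_bool (B (top_travel B i) i \<noteq> B (top_travel B i) (Suc i))"

text \<open>The mirror image, read from column \<open>N\<close> to the left: the value at \<open>i\<close> is the row after a possible
turn at \<open>i\<close>, and \<open>i\<close> can be at position \<open>bottom_travel r B N i\<close> of a positive chain that is complete
to the right of \<open>i\<close>.\<close>
function bottom_travel :: "nat \<Rightarrow> (nat \<Rightarrow> nat \<Rightarrow> bool) \<Rightarrow> nat \<Rightarrow> nat \<Rightarrow> nat" where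
  "bottom_travel r B N i = (if N \<le> i then r else bottom_travel r B N (Suc i) -
     of_bool (B (bottom_travel r B N (Suc i)) i \<noteq> B (bottom_travel r B N (Suc i)) (Suc i)))"
  by pat_completeness auto
termination by (relation "measure (\<lambda>(r, B, N, i). N - i)") auto

declare bottom_travel.simps [simp del]

lemma bottom_travel_last: "bottom_travel r B N N = r"
  by (simp add: bottom_travel.simps)

lemma bottom_travel_step:
  "i < N \<Longrightarrow> bottom_travel r B N i = bottom_travel r B N (Suc i) -
     of_bool (B (bottom_travel r B N (Suc i)) i \<noteq> B (bottom_travel r B N (Suc i)) (Suc i))"
  by (subst bottom_travel.simps) simp

lemma top_travel_ge_1: "1 \<le> top_travel B i"
  by (induction i) auto

lemma top_travel_forward: "forward B (positive_columns 0 i) (top_travel B i - 1) (i, True)"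
proof (induction i)
  case 0
  then show ?case by (auto simp: positive_columns_def intro: chain_to.start)
next
  case (Suc i)
  let ?A = "positive_columns 0 (Suc i)"
  obtain x where x: "top_travel B i = Suc x" using top_travel_ge_1[of B i] by (cases "top_travel B i") auto
  have IH: "forward B ?A x (i, True)"
    using Suc x by (auto simp: positive_columns_def elim: chain_to_mono)
  have mem: "(Suc i, True) \<in> ?A" by (auto simp: positive_columns_def)
  show ?case
  proof (cases "B (Suc x) i = B (Suc x) (Suc i)")
    case True
    then show ?thesis using x chain_to_later[OF _ IH _ mem] by simp
  next
    case False
    then have "forward B ?A (Suc x) (Suc i, True)"
      using mem by (intro chain_to.step[OF IH]) (auto simp: entry_def)
    then show ?thesis using x False by simp
  qed
qed

lemma bottom_travel_le: "i \<le> N \<Longrightarrow> bottom_travel r B N i \<le> r"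
proof (induction i rule: inc_induct)
  case base
  then show ?case by (simp add: bottom_travel_last)
next
  case (step i)
  then show ?case by (simp add: bottom_travel_step)
qed

lemma bottom_travel_backward:
  "i \<le> N \<Longrightarrow> backward r B (positive_columns i N) (r - bottom_travel r B N i) (i, True)"
proof (induction i rule: inc_induct)
  case base
  then show ?case by (auto simp: bottom_travel_last positive_columns_def intro: chain_to.start)
next
  case (step i)
  let ?A = "positive_columns i N" and ?y = "bottom_travel r B N (Suc i)"
  have IH: "backward r B ?A (r - ?y) (Suc i, True)"
    using step.IH by (auto simp: positive_columns_def elim: chain_to_mono)
  have mem: "(i, True) \<in> ?A" using step.hyps by (auto simp: positive_columns_def)
  show ?case
  proof (cases "?y = 0 \<or> B ?y i = B ?y (Suc i)")
    case True
    then have "bottom_travel r B N i = ?y" using step.hyps by (auto simp: bottom_travel_step)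
    then show ?thesis using chain_to_later[OF _ IH _ mem] by (simp add: transp_def)
  next
    case False
    have le: "?y \<le> r" using bottom_travel_le step.hyps by simp
    have "r - bottom_travel r B N i = Suc (r - ?y)"
      using False step.hyps le by (auto simp: bottom_travel_step)
    moreover have "backward r B ?A (Suc (r - ?y)) (i, True)"
      using False le mem by (intro chain_to.step[OF IH]) (auto simp: entry_def)
    ultimately show ?thesis by simp
  qed
qed

lemma top_le_bottom:
  assumes "om_acyclic (lawrence_circuits r B (Suc N))" and "i \<le> N"
  shows "top_travel B i \<le> bottom_travel r B N i"
proof (rule ccontr)
  let ?y = "bottom_travel r B N i"
  assume "\<not> top_travel B i \<le> ?y"
  then have "?y \<le> top_travel B i - 1" by simp
  then have "forward B (positive_columns 0 i) ?y (i, True)"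
    by (intro chain_to_shorten[OF _ top_travel_forward]) simp_all
  then have "forward B (positive_columns 0 N) ?y (i, True)"
    using assms(2) by (auto simp: positive_columns_def elim: chain_to_mono)
  moreover have "backward r B (positive_columns 0 N) (r - ?y) (i, True)"
    using bottom_travel_backward[OF assms(2), of B r]
    by (auto simp: positive_columns_def elim: chain_to_mono)
  ultimately have "\<exists>w. forward B (positive_columns 0 N) r w"
    using bottom_travel_le[OF assms(2)] by (intro splice_at)
  then show False using acyclic_no_full_chain[OF assms(1)] by blast
qed

text \<open>The completed chain is a circuit whose negative part is contained in \<open>{e}\<close>; acyclicity excludes
the empty negative part.\<close>
lemma interior_if_flipped_chain:
  assumes acyclic: "om_acyclic (lawrence_circuits r B (Suc N))"
    and A: "A = insert (e, False) (({..N} - {e}) \<times> {True})" and e: "e \<le> N" and k: "k \<le> r"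
    and "forward B A k (e, False)" and "backward r B A (r - k) (e, False)"
  shows "e \<in> interior_elements {..<Suc N} (lawrence_circuits r B (Suc N))"
proof -
  obtain w where w: "forward B A r w" using splice_at[OF assms(5,6) k] by blast
  have "fst z < Suc N" if "z \<in> A" for z using that e A by auto
  from circuit_of_forward[OF w this] obtain Z where
    Z: "Z \<in> lawrence_circuits r B (Suc N)" "snd Z \<subseteq> {c. (c, False) \<in> A}" by blast
  have "snd Z \<noteq> {}" using acyclic Z(1) by (auto simp: om_acyclic_def)
  then have "snd Z = {e}" using Z(2) A by auto
  then show ?thesis using Z(1) e by (auto simp: interior_elements_def)
qed

text \<open>Where the top travel passes \<open>e\<close> without turning, \<open>e\<close> agrees with column \<open>e - 1\<close> in the current row, so
the flipped \<open>e\<close> is one position further along than \<open>e\<close>; likewise the flipped \<open>e\<close> needs one column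
less on its right. If the rows differ by at most one, the two halves meet. At the first and last columns one of the
halves is a single column.\<close>
lemma interior_if_travels_adjacent:
  assumes acyclic: "om_acyclic (lawrence_circuits r B (Suc N))" and N: "0 < N" and e: "e \<le> N"
    and left: "if e = 0 then bottom_travel r B N 0 = 1 else top_travel B (e - 1) = top_travel B e"
    and right: "if e = N then top_travel B N = r else bottom_travel r B N (Suc e) = bottom_travel r B N e"
    and near: "bottom_travel r B N e \<le> top_travel B e + 1"
  shows "e \<in> interior_elements {..<Suc N} (lawrence_circuits r B (Suc N))"
proof -
  define A where "A = insert (e, False) (({..N} - {e}) \<times> {True})"
  define k where "k = (if e = N then r else bottom_travel r B N e - 1)"
  have mem: "(e, False) \<in> A" by (simp add: A_def)
  have range: "1 \<le> bottom_travel r B N e" "bottom_travel r B N e \<le> r"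
    using top_le_bottom[OF acyclic e] top_travel_ge_1[of B e] bottom_travel_le[OF e, of r B] by auto
  have "forward B A k (e, False)"
  proof (cases e)
    case 0
    then have "k = 0" using left N by (simp add: k_def)
    then show ?thesis using mem by (auto intro: chain_to.start)
  next
    case (Suc e')
    define x where "x = top_travel B e"
    have x': "top_travel B e' = x" using left Suc by (simp add: x_def)
    then have x: "B x e' = B x e" "1 \<le> x"
      using Suc top_travel_ge_1[of B e'] by (auto simp: x_def split: if_splits)
    have "positive_columns 0 e' \<subseteq> A" using Suc e by (auto simp: A_def positive_columns_def)
    then have "forward B A (x - 1) (e', True)"
      using chain_to_mono[OF top_travel_forward[of B e']] x' by auto
    then have "forward B A (Suc (x - 1)) (e, False)"
      using x Suc mem by (intro chain_to.step[where y = "(e', True)"]) (auto simp: entry_def)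
    then have "forward B A x (e, False)" using x by simp
    moreover have "k \<le> x" using near right by (auto simp: k_def x_def)
    ultimately show ?thesis by (auto intro: chain_to_shorten)
  qed
  moreover have "backward r B A (r - k) (e, False)"
  proof (cases "e = N")
    case True
    then show ?thesis using mem by (auto simp: k_def intro: chain_to.start)
  next
    case False
    then have eN: "e < N" using e by simp
    define y where "y = bottom_travel r B N e"
    have y': "bottom_travel r B N (Suc e) = y" using right False by (simp add: y_def)
    have range_y: "1 \<le> y" "y \<le> r" using range by (simp_all add: y_def)
    have "y = y - of_bool (B y e \<noteq> B y (Suc e))"
      using bottom_travel_step[OF eN, of r B] unfolding y' y_def[symmetric] .
    then have y: "B y e = B y (Suc e)" "1 \<le> y" "y \<le> r"
      using range_y by (cases "B y e = B y (Suc e)"; simp)+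
    have "positive_columns (Suc e) N \<subseteq> A" by (auto simp: A_def positive_columns_def)
    then have "backward r B A (r - y) (Suc e, True)"
      using chain_to_mono[OF bottom_travel_backward[of "Suc e" N B r]] y' eN by auto
    then have "backward r B A (Suc (r - y)) (e, False)"
      using y mem by (intro chain_to.step[where y = "(Suc e, True)"]) (auto simp: entry_def)
    moreover have "r - k = Suc (r - y)" using y False by (auto simp: k_def y_def)
    ultimately show ?thesis by simp
  qed
  ultimately show ?thesis
    using range by (intro interior_if_flipped_chain[OF acyclic A_def e, of k]) (auto simp: k_def)
qed

section \<open>A potential for pairs of travels\<close>

text \<open>The breakpoint sequence, as integers. The values at \<open>r + 1\<close> and \<open>r + 2\<close> belong to no row; they
continue the sequence so that the potential below has one formula for all rows \<open>y \<le> r\<close>, and their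
offsets \<open>3\<close> and \<open>5\<close> are chosen to make it small at the right end (\<open>potential_end\<close>).\<close>
locale breakpoints =
  fixes t r :: nat and s :: "nat \<Rightarrow> int"
  assumes t: "t \<ge> 2" and r: "r \<ge> 3"
    and s_1: "s 1 = 1"
    and dwell: "1 \<le> y \<Longrightarrow> y < r \<Longrightarrow> s y + 2 \<le> s (y + 1)"
    and dwell_pair: "1 \<le> y \<Longrightarrow> y + 2 \<le> r \<Longrightarrow> s y + int t + 3 \<le> s (y + 2)"
    and s_end: "s (r + 1) = s r + 3" "s (r + 2) = s r + 5"
begin

lemma dwell': "1 \<le> y \<Longrightarrow> y \<le> r + 1 \<Longrightarrow> s y + 2 \<le> s (y + 1)"
proof -
  assume "1 \<le> y" "y \<le> r + 1"
  then consider "1 \<le> y \<and> y < r" | "y = r" | "y = r + 1" by linarith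
  then show ?thesis using dwell[of y] s_end by cases auto
qed

lemma dwell_pair': "1 \<le> y \<Longrightarrow> y \<le> r \<Longrightarrow> s y + 5 \<le> s (y + 2)"
proof -
  assume "1 \<le> y" "y \<le> r"
  then consider "1 \<le> y \<and> y + 2 \<le> r" | "y = r" | "1 \<le> y \<and> y + 1 = r" by linarith
  then show ?thesis using dwell_pair[of y] dwell[of y] s_end t by cases auto
qed

lemma dwell_gap:
  assumes "1 \<le> x" and "x + 2 + k \<le> r"
  shows "s x + int t + 3 + int k \<le> s (x + 2 + k)"
  using assms(2)
proof (induction k)
  case 0
  then show ?case using dwell_pair[of x] assms(1) by simp
next
  case (Suc k)
  then show ?case using dwell[of "x + 2 + k"] assms(1) by simp
qed

lemma s_mono:
  assumes "1 \<le> x" "x \<le> y" "y \<le> r"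
  shows "s x \<le> s y"
  using assms(2,3)
proof (induction rule: dec_induct)
  case (step y)
  then show ?case using dwell[of y] assms(1) by simp
qed simp

text \<open>Let the travels be in rows \<open>x \<le> y\<close> at column \<open>i\<close>. While the breakpoint lies between them, every step
costs a turn; the \<open>s y - i\<close> steps before it reaches row \<open>y\<close> can be spent on the \<open>y - x - 2\<close> turns of the top travel
that leave the travels two rows apart. The first line of the potential is the resulting
excess of steps. A turn of the top travel leaves it unchanged, a turn of the bottom travel increases it
by the distance of the breakpoints at \<open>y\<close> and \<open>y + 1\<close> minus \<open>2\<close>, and an idle step decreases it by \<open>1\<close>.

The correction is for travels less than two rows apart. They can only separate again by turns of the
bottom travel, and the increases caused by these one or two turns are credited in advance. The flag
\<open>f\<close> tells that the top travel turned at column \<open>i\<close>. Such a column is not charged even if the next step is idle,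
so the credit is smaller by \<open>1\<close>; the maximum keeps a turn that makes the travels adjacent from losing potential.\<close>
definition potential :: "nat \<Rightarrow> nat \<Rightarrow> nat \<Rightarrow> bool \<Rightarrow> int" where
  "potential i x y f =
     s y - int i - (int y - int x - 2) +
     (if y = x then s (y + 2) - s y - 4 - of_bool f
      else if y = x + 1 then (if f then max (s (y + 1) - s y - 3) 0 else s (y + 1) - s y - 2)
      else 0)"

text \<open>The charge counts the columns that are interior by the criterion for travels; \<open>U\<close> tells
that the bottom travel turns at the column.\<close>
definition charge :: "nat \<Rightarrow> nat \<Rightarrow> bool \<Rightarrow> bool \<Rightarrow> int" where
  "charge x y f U = of_bool (\<not> f \<and> \<not> U \<and> y \<le> x + 1)"

lemma step_T:
  assumes "1 \<le> x" "x < y" "y \<le> r"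
  shows "potential (i + 1) (x + 1) y True \<ge> potential i x y f - charge x y f False"
proof -
  consider "y = x + 1" | "y = x + 2" | "y > x + 2" using assms by linarith
  then show ?thesis
    using assms dwell_pair'[of y] dwell'[of y] dwell'[of "y + 1"]
    by cases (auto simp: potential_def charge_def of_nat_diff add.assoc split: if_splits)
qed

lemma step_U:
  assumes "1 \<le> x" "x \<le> y" "y < r"
  shows "potential (i + 1) x (y + 1) False \<ge> potential i x y f"
proof -
  consider "y = x" | "y = x + 1" | "y > x + 1" using assms by linarith
  then show ?thesis
    using assms dwell_pair'[of y] dwell'[of y] dwell'[of "y + 1"]
    by cases (auto simp: potential_def add.assoc)
qed

lemma step_both:
  assumes "1 \<le> x" "x \<le> y" "y < r"
  shows "potential (i + 1) (x + 1) (y + 1) True \<ge> potential i x y f"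
proof -
  consider "y = x" | "y = x + 1" | "y > x + 1" using assms by linarith
  then show ?thesis
    using assms dwell_pair'[of y] dwell_pair'[of "y + 1"] dwell'[of y] dwell'[of "y + 1"] dwell'[of "y + 2"]
    by cases (auto simp: potential_def add.assoc)
qed

text \<open>Idle steps are the only ones that can lose potential without a charge. If such a loss happens before
the breakpoint reaches row \<open>x\<close>, two whole breakpoint distances are still to come and the potential stays at
least \<open>t + 2\<close>; if it happens after the breakpoint has reached row \<open>y\<close>, the potential is already at
most \<open>1\<close>. Neither affects the invariant of \<open>charge_bound\<close>.\<close>
lemma step_none:
  assumes "1 \<le> x" "x \<le> y" "y \<le> r" and "\<not> (s x \<le> int i \<and> int i < s y)"
  shows "potential i x y f \<le> 1 \<or> potential (i + 1) x y False \<ge> int t + 2 \<or>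
    potential (i + 1) x y False \<ge> potential i x y f - charge x y f False"
proof -
  have "y = x \<or> y = x + 1 \<or> (\<exists>k. y = x + 2 + k)"
    using assms(2) le_Suc_ex[of "x + 2" y] by (cases "x + 2 \<le> y") auto
  then consider "y = x" | "y = x + 1" | k where "y = x + 2 + k" by blast
  then show ?thesis
  proof cases
    case 1
    then show ?thesis
      by (auto simp: potential_def charge_def)
  next
    case 2
    show ?thesis
    proof (cases "f \<and> s (y + 1) - s y < 3")
      case False
      then show ?thesis using 2 by (auto simp: potential_def charge_def)
    next
      case True
      then have l: "s (y + 1) - s y = 2" using dwell'[of y] assms by auto
      then have "y < r" using s_end assms(3) by (cases "y = r") auto
      then have p: "s x + int t + 3 \<le> s (y + 1)" using dwell_pair[of x] 2 assms(1) by (auto simp: add.assoc)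
      show ?thesis
      proof (cases "int i < s x")
        case True
        then show ?thesis using p l 2 by (auto simp: potential_def)
      next
        case False
        then have "s y \<le> int i" using assms(4) by auto
        then show ?thesis using \<open>f \<and> _\<close> 2 by (auto simp: potential_def)
      qed
    qed
  next
    case 3
    show ?thesis
    proof (cases "int i < s x")
      case True
      then show ?thesis using dwell_gap[of x k] assms 3 by (auto simp: potential_def)
    next
      case False
      then show ?thesis using assms(4) 3 by (auto simp: potential_def)
    qed
  qed
qed

lemma potential_start:
  assumes "1 \<le> q" "q \<le> r"
  shows "potential 0 1 q (q \<noteq> 1) \<ge> int t + 2"
proof -
  have "q = 1 \<or> q = 2 \<or> (\<exists>k. q = 1 + 2 + k)"
    using assms(1) le_Suc_ex[of "1 + 2" q] by (cases "1 + 2 \<le> q") auto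
  then consider "q = 1" | "q = 2" | k where "q = 1 + 2 + k" by blast
  then show ?thesis
  proof cases
    case 1
    then show ?thesis using dwell_pair[of 1] r s_1 by (simp add: potential_def numeral_3_eq_3)
  next
    case 2
    then show ?thesis using dwell_pair[of 1] dwell[of 1] r s_1
      by (auto simp: potential_def numeral_3_eq_3 numeral_2_eq_2)
  next
    case 3
    then show ?thesis using dwell_gap[of 1 k] assms s_1 by (auto simp: potential_def)
  qed
qed

lemma potential_end:
  assumes "int N = s r + 1" "x \<le> r"
  shows "potential N x r f \<le> 1 + of_bool (\<not> f \<and> x = r)"
  using assms s_end by (auto simp: potential_def)

text \<open>The invariant is that the charges so far plus the potential, replaced by \<open>1\<close> if it is smaller, are at
least \<open>t + 2\<close>. At the end the potential is at most \<open>1\<close>, unless the last column is itself interior.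
The flag at column \<open>0\<close> lets this column count only if the bottom travel is in row \<open>1\<close> there, too.\<close>
lemma charge_bound:
  fixes X Y :: "nat \<Rightarrow> nat"
  assumes N: "int N = s r + 1"
    and start: "X 0 = 1" and finish: "Y N = r"
    and le: "\<And>i. i \<le> N \<Longrightarrow> 1 \<le> X i \<and> X i \<le> Y i \<and> Y i \<le> r"
    and X: "\<And>i. i < N \<Longrightarrow> X (Suc i) = X i \<or> X (Suc i) = Suc (X i)"
    and Y: "\<And>i. i < N \<Longrightarrow> Y (Suc i) = Y i \<or> Y (Suc i) = Suc (Y i)"
    and turn: "\<And>i. i < N \<Longrightarrow> (X (Suc i) \<noteq> X i) \<noteq> (Y (Suc i) \<noteq> Y i) \<longleftrightarrow>
      s (X i) \<le> int i \<and> int i < s (Y (Suc i))"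
  defines "f \<equiv> \<lambda>i. if i = 0 then Y 0 \<noteq> 1 else X (i - 1) \<noteq> X i"
  shows "int t + 1 \<le> (\<Sum>i<N. charge (X i) (Y i) (f i) (Y i \<noteq> Y (Suc i))) + of_bool (\<not> f N \<and> X N = r)"
proof -
  have charge_nonneg: "0 \<le> (\<Sum>i<m. charge (X i) (Y i) (f i) (Y i \<noteq> Y (Suc i)))" for m
    by (intro sum_nonneg) (simp add: charge_def)
  have "int t + 2 \<le> (\<Sum>i<m. charge (X i) (Y i) (f i) (Y i \<noteq> Y (Suc i))) + max (potential m (X m) (Y m) (f m)) 1"
    if "m \<le> N" for m
    using that
  proof (induction m)
    case 0
    then show ?case using potential_start[of "Y 0"] le[of 0] start by (auto simp: f_def)
  next
    case (Suc m)
    let ?c = "charge (X m) (Y m) (f m) (Y m \<noteq> Y (Suc m))"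
    have m: "m < N" using Suc.prems by simp
    have f: "f (Suc m) = (X (Suc m) \<noteq> X m)" by (auto simp: f_def)
    have lm: "1 \<le> X m" "X m \<le> Y m" "Y m \<le> r" and lm': "X (Suc m) \<le> Y (Suc m)" "Y (Suc m) \<le> r"
      using le[of m] le[of "Suc m"] m by auto
    have c0: "0 \<le> ?c" by (simp add: charge_def)
    have "potential m (X m) (Y m) (f m) \<le> 1 \<or>
        potential (Suc m) (X (Suc m)) (Y (Suc m)) (f (Suc m)) \<ge> int t + 2 \<or>
        potential (Suc m) (X (Suc m)) (Y (Suc m)) (f (Suc m)) \<ge> potential m (X m) (Y m) (f m) - ?c"
    proof -
      consider (none) "X (Suc m) = X m" "Y (Suc m) = Y m"
        | (T) "X (Suc m) = Suc (X m)" "Y (Suc m) = Y m"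
        | (U) "X (Suc m) = X m" "Y (Suc m) = Suc (Y m)"
        | (both) "X (Suc m) = Suc (X m)" "Y (Suc m) = Suc (Y m)"
        using X[OF m] Y[OF m] by auto
      then show ?thesis
      proof cases
        case none
        then show ?thesis using step_none[of "X m" "Y m" m "f m"] lm turn[OF m] f by auto
      next
        case T
        then show ?thesis using step_T[of "X m" "Y m" m "f m"] lm lm' f by auto
      next
        case U
        then show ?thesis using step_U[of "X m" "Y m" m "f m"] lm lm' f c0 by auto
      next
        case both
        then show ?thesis using step_both[of "X m" "Y m" m "f m"] lm lm' f c0 by auto
      qed
    qed
    then show ?case using Suc.IH m c0 charge_nonneg[of m] by (auto simp: max_def split: if_splits)
  qed
  from this[of N] show ?thesis
    using potential_end[OF N, of "X N" "f N"] finish le[of N] charge_nonneg[of N]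
    by (auto simp: max_def split: if_splits)
qed

end

section \<open>The matrix with many interior elements\<close>

definition staircase :: "(nat \<Rightarrow> nat) \<Rightarrow> nat \<Rightarrow> nat \<Rightarrow> bool" where
  "staircase \<sigma> k c \<longleftrightarrow> even (min c (\<sigma> k))"

text \<open>Row \<open>k\<close> changes sign exactly on the steps before its breakpoint. Two rows therefore behave differently on step \<open>i\<close>
exactly if one breakpoint has been reached and the other has not, and column flips do not affect this comparison.\<close>
lemma staircase_Suc: "staircase \<sigma> k (Suc i) \<noteq> staircase \<sigma> k i \<longleftrightarrow> i < \<sigma> k"
  by (auto simp: staircase_def min_def Suc_le_eq)

lemma many_interior_elements:
  assumes "breakpoints t r (\<lambda>k. int (\<sigma> k))" and N: "N = \<sigma> r + 1"
    and B: "B = flip_columns A (staircase \<sigma>)"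
    and acyclic: "om_acyclic (lawrence_circuits r B (Suc N))"
  shows "t + 1 \<le> card (interior_elements {..<Suc N} (lawrence_circuits r B (Suc N)))"
proof -
  interpret breakpoints t r "\<lambda>k. int (\<sigma> k)" by fact
  define X where "X = top_travel B"
  define Y where "Y = bottom_travel r B N"
  have le: "1 \<le> X i \<and> X i \<le> Y i \<and> Y i \<le> r" if "i \<le> N" for i
    using that top_travel_ge_1 top_le_bottom[OF acyclic] bottom_travel_le by (simp add: X_def Y_def)
  have XS: "X (Suc i) = X i + of_bool (B (X i) i \<noteq> B (X i) (Suc i))" for i
    by (simp add: X_def)
  have YS: "Y i = Y (Suc i) - of_bool (B (Y (Suc i)) i \<noteq> B (Y (Suc i)) (Suc i))" if "i < N" for i
    using that by (simp add: Y_def bottom_travel_step)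
  have Ypos: "1 \<le> Y (Suc i)" if "i < N" for i using le[of "Suc i"] that by simp
  have turn: "(X (Suc i) \<noteq> X i) \<noteq> (Y (Suc i) \<noteq> Y i) \<longleftrightarrow>
      int (\<sigma> (X i)) \<le> int i \<and> int i < int (\<sigma> (Y (Suc i)))" if "i < N" for i
  proof -
    have T: "X (Suc i) \<noteq> X i \<longleftrightarrow> B (X i) i \<noteq> B (X i) (Suc i)"
      and U: "Y (Suc i) \<noteq> Y i \<longleftrightarrow> B (Y (Suc i)) i \<noteq> B (Y (Suc i)) (Suc i)"
      using XS[of i] YS[OF that] Ypos[OF that] by auto
    have turns: "B k i \<noteq> B k (Suc i) \<longleftrightarrow> (i < \<sigma> k) \<noteq> ((i \<in> A) \<noteq> (Suc i \<in> A))" for k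
      using staircase_Suc[of \<sigma> k i] by (auto simp: B flip_columns_def)
    have "\<sigma> (X i) \<le> \<sigma> (Y (Suc i))"
    proof -
      have "X i \<le> Y (Suc i)" using le[of i] YS[OF that] that by auto
      then show ?thesis using s_mono[of "X i" "Y (Suc i)"] le[of i] le[of "Suc i"] that by auto
    qed
    then show ?thesis unfolding T U turns by auto
  qed
  \<comment> \<open>\<open>f\<close> and \<open>P\<close> spell out the flag and the charge at each column.\<close>
  define f where "f i = (if i = 0 then Y 0 \<noteq> 1 else X (i - 1) \<noteq> X i)" for i
  define P where "P i = (\<not> f i \<and> Y i = Y (Suc i) \<and> Y i \<le> X i + 1)" for i
  have "int t + 1 \<le> (\<Sum>i<N. charge (X i) (Y i) (f i) (Y i \<noteq> Y (Suc i))) + of_bool (\<not> f N \<and> X N = r)"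
    unfolding f_def
  proof (rule charge_bound)
    show "X 0 = 1" "Y N = r" by (simp_all add: X_def Y_def bottom_travel_last)
    show "X (Suc i) = X i \<or> X (Suc i) = Suc (X i)" for i using XS[of i] by auto
    show "Y (Suc i) = Y i \<or> Y (Suc i) = Suc (Y i)" if "i < N" for i using YS[OF that] Ypos[OF that] by auto
  qed (use N le turn in auto)
  also have "\<dots> = int (card ({..<N} \<inter> {i. P i})) + of_bool (\<not> f N \<and> X N = r)"
    by (simp add: charge_def P_def conj_commute flip: sum_of_bool_eq)
  also have "\<dots> = int (card (({..<N} \<inter> {i. P i}) \<union> (if \<not> f N \<and> X N = r then {N} else {})))"
    by (subst card_Un_disjoint) auto
  also have "\<dots> \<le> int (card (interior_elements {..<Suc N} (lawrence_circuits r B (Suc N))))"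
  proof -
    have N0: "0 < N" using N by simp
    have int: "i \<in> interior_elements {..<Suc N} (lawrence_circuits r B (Suc N))" if "i < N" "P i" for i
      using that by (intro interior_if_travels_adjacent[OF acyclic N0])
        (auto simp: P_def f_def X_def Y_def split: if_splits)
    moreover have "N \<in> interior_elements {..<Suc N} (lawrence_circuits r B (Suc N))"
      if "\<not> f N" "X N = r"
      using that N0 by (intro interior_if_travels_adjacent[OF acyclic N0])
        (auto simp: f_def X_def Y_def bottom_travel_last split: if_splits)
    ultimately have "({..<N} \<inter> {i. P i}) \<union> (if \<not> f N \<and> X N = r then {N} else {}) \<subseteq>
        interior_elements {..<Suc N} (lawrence_circuits r B (Suc N))"
      by auto
    moreover have "finite (interior_elements {..<Suc N} (lawrence_circuits r B (Suc N)))"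
      by (simp add: interior_elements_def)
    ultimately show ?thesis by (simp add: card_mono)
  qed
  finally show ?thesis by simp
qed

text \<open>Breakpoints two rows apart differ by \<open>t + 3\<close>, split as evenly as possible between the two distances. The
last one absorbs the surplus of columns, and the rows beyond \<open>r\<close> follow the convention of the locale.\<close>
definition breakpoint :: "nat \<Rightarrow> nat \<Rightarrow> nat \<Rightarrow> nat \<Rightarrow> nat" where
  "breakpoint t r m k =
     (if k < r then 1 + ((k - 1) * (t + 3)) div 2
      else if k = r then m - 2 else if k = r + 1 then m + 1 else m + 3)"

lemma breakpoints_breakpoint:
  assumes "t \<ge> 2" and "h \<ge> 1" and m: "m \<ge> (t + 3) * h + 3" and r: "r = 2 * h + 1"
  shows "breakpoints t r (\<lambda>k. int (breakpoint t r m k))"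
proof -
  define b where "b k = 1 + ((k - 1) * (t + 3)) div 2" for k
  have b: "breakpoint t r m k = b k" if "k < r" for k using that by (simp add: breakpoint_def b_def)
  have br: "b r \<le> breakpoint t r m r" using m r by (simp add: breakpoint_def b_def algebra_simps)
  have b_le: "b k \<le> breakpoint t r m k" if "k \<le> r" for k
    using b[of k] br that by (cases "k = r") auto
  have b1: "b k + 2 \<le> b (k + 1)" if k: "1 \<le> k" for k
  proof -
    obtain z where "k = Suc z" using k by (cases k) auto
    moreover have "p div 2 + 2 \<le> (t + 3 + p) div 2" for p using assms(1) by linarith
    ultimately show ?thesis by (simp add: b_def)
  qed
  have b2: "b (k + 2) = b k + t + 3" if k: "1 \<le> k" for k
  proof -
    obtain z where z: "k = Suc z" using k by (cases k) auto
    have "(z + 2) * (t + 3) = z * (t + 3) + (t + 3) * 2" by (simp add: algebra_simps)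
    then have "((z + 2) * (t + 3)) div 2 = (z * (t + 3)) div 2 + (t + 3)" by simp
    then show ?thesis using z by (simp add: b_def)
  qed
  show ?thesis
  proof
    show "int (breakpoint t r m k) + 2 \<le> int (breakpoint t r m (k + 1))" if "1 \<le> k" "k < r" for k
      using b[of k] b1[of k] b_le[of "k + 1"] that by simp
    show "int (breakpoint t r m k) + int t + 3 \<le> int (breakpoint t r m (k + 2))"
      if "1 \<le> k" "k + 2 \<le> r" for k
      using b[of k] b2[of k] b_le[of "k + 2"] that by simp
  qed (use assms in \<open>auto simp: breakpoint_def of_nat_diff\<close>)
qed

lemma not_reorientable:
  assumes "t \<ge> 2" and "h \<ge> 1" and "m \<ge> (t + 3) * h + 3"
  shows "\<not> reorientable t (2 * h) m"
proof
  assume reo: "reorientable t (2 * h) m"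
  define r where "r = 2 * h + 1"
  define a where "a = staircase (breakpoint t r m)"
  have bp: "breakpoints t r (\<lambda>k. int (breakpoint t r m k))"
    using assms by (intro breakpoints_breakpoint) (auto simp: r_def)
  have "2 * h \<le> (t + 3) * h" by simp
  then have rm: "r \<le> m" using assms(3) unfolding r_def by linarith
  obtain A where A: "om_acyclic (reorient A (lawrence_circuits r a m))"
    "card (interior_elements {..<m} (reorient A (lawrence_circuits r a m))) \<le> t"
    using reo lawrence_oriented_matroid[of m r a] lawrence_uniform[OF rm, of a] lawrence_rank[OF rm, of a]
    unfolding reorientable_def r_def[symmetric] by (metis card_lessThan r_def)
  have N: "Suc (breakpoint t r m r + 1) = m" using assms(3) by (simp add: breakpoint_def)
  show False
    using many_interior_elements[OF bp refl refl, of A] A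
    unfolding reorient_lawrence N a_def[symmetric] by simp
qed

section \<open>The upper bound\<close>

theorem theorem8:
  fixes t d :: nat
  assumes "even d" and "d \<ge> 4" and "t \<ge> 2"
  shows "real (n_bar t d) < 2 * real d + (real t - 1) * (real d / 2) + 3"
proof -
  obtain h where h: "d = 2 * h" using assms(1) by blast
  have bound: "m < (t + 3) * h + 3" if "reorientable t d m" for m
    using not_reorientable[of t h m] that assms h by (cases "m < (t + 3) * h + 3") auto
  \<comment> \<open>Some \<open>m\<close> must qualify for the maximum to exist; no oriented matroid with empty ground set
    has positive rank.\<close>
  have "reorientable t d 0"
    unfolding reorientable_def
  proof (intro allI impI)
    fix E :: "nat set" and \<C>
    assume "oriented_matroid E \<C> \<and> om_uniform E \<C> \<and> om_rank E \<C> = d + 1 \<and> card E = 0"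
    then have om: "oriented_matroid E \<C>" and rank: "om_rank E \<C> = d + 1" and card: "card E = 0"
      by auto
    have "E = {}" using card oriented_matroid.finite_ground[OF om] by simp
    have "\<not> support X \<subseteq> {}" if "X \<in> \<C>" for X
      using that oriented_matroid.empty_not_circuit[OF om] by (cases X) (auto simp: support_def)
    then have "{I. om_indep E \<C> I} = {{}}" using \<open>E = {}\<close> by (auto simp: om_indep_def)
    then have "om_rank E \<C> = 0" by (simp add: om_rank_def)
    then show "\<exists>A\<subseteq>E. om_acyclic (reorient A \<C>) \<and> card (interior_elements E (reorient A \<C>)) \<le> t"
      using rank by simp
  qed
  then have "reorientable t d (n_bar t d)"
    unfolding n_bar_def by (rule GreatestI_nat) (rule less_imp_le[OF bound])
  then have "n_bar t d < (t + 3) * h + 3" by (rule bound)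
  then have "real (n_bar t d) < real ((t + 3) * h + 3)" by (simp only: of_nat_less_iff)
  then show ?thesis by (simp add: h algebra_simps)
qed

end
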